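(* If $M$ is a separable complete uniformly Gromov concave metric space (with a distinguished base point), then $\operatorname{Lip}_0(M)$ has the uniform ball-covering property (UBCP) and $\operatorname{bc}(\operatorname{Lip}_0(M))=1$.
   Context: Let $(M,d)$ be a complete metric space with a distinguished point $0\in M$. $\operatorname{Lip}_0(M)$ is the real Banach space of all Lipschitz functions $f:M\to\mathbb R$ with $f(0)=0$, with norm $\|f\|=\sup\{|f(x)-f(y)|/d(x,y):x\ne y\in M\}$. For $x,y,z\in M$ the Gromov product of $x$ and $y$ at $z$ is $(x,y)_z:=\frac12(d(x,z)+d(z,y)-d(x,y))$. $M$ is uniformly Gromov concave if there is $\varepsilon_0>0$ such that $(x,y)_z>\varepsilon_0\min\{d(x,z),d(y,z)\}$ for all distinct $x,y,z\in M$. For a Banach space $Z$, $S_Z$ is its unit sphere and $B(z,r)$ the open ball with center $z$ and radius $r>0$. $Z$ has the UBCP if there are $r,\alpha>0$ and a countable collection of open balls $\{B(z_n,r_n)\}$ with $S_Z\subset\bigcup_nB(z_n,r_n)$, $\|z_n\|\ge r_n+\alpha$ for all $n$, and $\sup_n r_n\le r$. For $\alpha\in[-1,1)$, $Z$ has the $\alpha$-BCP if there is a countable collection of open balls $\{B(z_n,r_n)\}$, $r_n>0$, with $S_Z\subset\bigcup_n B(z_n,r_n)$ and $\|z_n\|\ge r_n+\alpha$ for all $n$. The ball-covering index is $\operatorname{bc}(Z):=\sup\{\alpha\in[-1,1): Z\text{ has the }\alpha\text{-BCP}\}$ ($=-1$ if this set is empty). *)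

theory Defs
  imports "HOL-Analysis.Analysis"
begin

text \<open>
  A pointed metric space is a type of sort \<open>{metric_space, zero}\<close>. The class \<open>zero\<close> has no
  axioms, so \<open>0\<close> is an arbitrary distinguished point and carries no algebraic meaning.
\<close>

typedef (overloaded) 'a lip0 =
  "{f :: 'a::{metric_space, zero} \<Rightarrow> real. (\<exists>C. C-lipschitz_on UNIV f) \<and> f 0 = 0}"
  morphisms apply_lip0 Lip0
  by (rule exI[of _ "\<lambda>_. 0"]) (auto intro: lipschitz_intros)

setup_lifting type_definition_lip0

lemma lip0_eqI: "(\<And>x. apply_lip0 f x = apply_lip0 g x) \<Longrightarrow> f = g"
  by (metis apply_lip0_inject ext)

lemma apply_lip0_0 [simp]: "apply_lip0 f 0 = 0"
  using apply_lip0[of f] by simp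

text \<open>
  The value \<open>0\<close> is inserted so that the supremum is \<open>0\<close> when the space is a single
  point; otherwise it is redundant, as all the quotients are nonnegative.
\<close>

definition lip_norm :: "('a::metric_space \<Rightarrow> real) \<Rightarrow> real" where
  "lip_norm f = Sup (insert 0 {\<bar>f x - f y\<bar> / dist x y | x y. x \<noteq> y})"

lemma lip_norm_le:
  assumes "0 \<le> C" "\<And>x y. \<bar>f x - f y\<bar> \<le> C * dist x y"
  shows "lip_norm f \<le> C"
  unfolding lip_norm_def using assms by (auto intro!: cSup_least simp: divide_le_eq)

context
  fixes f :: "'a::metric_space \<Rightarrow> real"
  assumes lip: "\<exists>C. C-lipschitz_on UNIV f"
begin

lemma bdd_above_slopes:
  "bdd_above (insert 0 {\<bar>f x - f y\<bar> / dist x y | x y. x \<noteq> y})"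
proof -
  obtain C where "C-lipschitz_on UNIV f"
    using lip by blast
  then have "0 \<le> C" "\<bar>f x - f y\<bar> \<le> C * dist x y" for x y
    by (auto simp: lipschitz_on_def dist_real_def)
  then show ?thesis
    by (intro bdd_aboveI[of _ C]) (auto simp: divide_le_eq)
qed

lemma lip_norm_nonneg: "0 \<le> lip_norm f"
  unfolding lip_norm_def by (rule cSup_upper[OF _ bdd_above_slopes]) simp

lemma lip_norm_bound: "\<bar>f x - f y\<bar> \<le> lip_norm f * dist x y"
proof (cases "x = y")
  case False
  then have "\<bar>f x - f y\<bar> / dist x y \<le> lip_norm f"
    unfolding lip_norm_def by (intro cSup_upper[OF _ bdd_above_slopes]) blast
  then show ?thesis
    using False by (simp add: divide_le_eq)
qed simp

end

instantiation lip0 :: ("{metric_space, zero}") real_normed_vector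
begin

lift_definition norm_lip0 :: "'a lip0 \<Rightarrow> real" is lip_norm .

lift_definition zero_lip0 :: "'a lip0" is "\<lambda>_. 0"
  by (auto intro: lipschitz_intros)

lift_definition plus_lip0 :: "'a lip0 \<Rightarrow> 'a lip0 \<Rightarrow> 'a lip0" is "\<lambda>f g x. f x + g x"
  by (auto intro: lipschitz_intros)

lift_definition uminus_lip0 :: "'a lip0 \<Rightarrow> 'a lip0" is "\<lambda>f x. - f x"
  by (auto intro: lipschitz_intros)

lift_definition minus_lip0 :: "'a lip0 \<Rightarrow> 'a lip0 \<Rightarrow> 'a lip0" is "\<lambda>f g x. f x - g x"
  by (auto intro: lipschitz_intros)

lift_definition scaleR_lip0 :: "real \<Rightarrow> 'a lip0 \<Rightarrow> 'a lip0" is "\<lambda>c f x. c * f x"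
  by (auto intro: lipschitz_on_cmult_real)

definition sgn_lip0 :: "'a lip0 \<Rightarrow> 'a lip0" where
  "sgn_lip0 f = scaleR (inverse (norm f)) f"

definition dist_lip0 :: "'a lip0 \<Rightarrow> 'a lip0 \<Rightarrow> real" where
  "dist_lip0 f g = norm (f - g)"

definition uniformity_lip0 :: "('a lip0 \<times> 'a lip0) filter" where
  "uniformity_lip0 = (INF e\<in>{0 <..}. principal {(x, y). dist x y < e})"

definition open_lip0 :: "'a lip0 set \<Rightarrow> bool" where
  "open_lip0 S = (\<forall>x\<in>S. \<forall>\<^sub>F (x', y) in uniformity. x' = x \<longrightarrow> y \<in> S)"

lemma norm_lip0_bound: "\<bar>apply_lip0 f x - apply_lip0 f y\<bar> \<le> norm f * dist x y"
  by transfer (blast intro: lip_norm_bound)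

lemma norm_lip0_nonneg: "0 \<le> norm (f :: 'a lip0)"
  by transfer (blast intro: lip_norm_nonneg)

lemma norm_lip0_le:
  "0 \<le> C \<Longrightarrow> (\<And>x y. \<bar>apply_lip0 f x - apply_lip0 f y\<bar> \<le> C * dist x y) \<Longrightarrow> norm f \<le> C"
  by transfer (rule lip_norm_le)

lemma norm_lip0_scaleR_le: "norm (c *\<^sub>R f) \<le> \<bar>c\<bar> * norm (f :: 'a lip0)"
proof (rule norm_lip0_le)
  fix x y
  have "\<bar>apply_lip0 (c *\<^sub>R f) x - apply_lip0 (c *\<^sub>R f) y\<bar> = \<bar>c\<bar> * \<bar>apply_lip0 f x - apply_lip0 f y\<bar>"
    by (simp add: scaleR_lip0.rep_eq abs_mult flip: right_diff_distrib)
  also have "\<dots> \<le> \<bar>c\<bar> * (norm f * dist x y)"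
    by (intro mult_left_mono norm_lip0_bound) simp
  finally show "\<bar>apply_lip0 (c *\<^sub>R f) x - apply_lip0 (c *\<^sub>R f) y\<bar> \<le> \<bar>c\<bar> * norm f * dist x y"
    by (simp add: mult.assoc)
qed (simp add: norm_lip0_nonneg)

instance
proof
  fix a b :: real and f g h :: "'a lip0"
  show "f + g + h = f + (g + h)" "f + g = g + f" "0 + f = f" "- f + f = 0" "f - g = f + - g"
    "a *\<^sub>R (f + g) = a *\<^sub>R f + a *\<^sub>R g" "(a + b) *\<^sub>R f = a *\<^sub>R f + b *\<^sub>R f"
    "a *\<^sub>R b *\<^sub>R f = (a * b) *\<^sub>R f" "1 *\<^sub>R f = f"
    by (transfer, simp add: fun_eq_iff algebra_simps)+
  show "dist f g = norm (f - g)"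
    by (rule dist_lip0_def)
  show "sgn f = scaleR (inverse (norm f)) f"
    by (rule sgn_lip0_def)
  show "uniformity = (INF e\<in>{0 <..}. principal {(x :: 'a lip0, y). dist x y < e})"
    by (rule uniformity_lip0_def)
  show "open S = (\<forall>x\<in>S. \<forall>\<^sub>F (x', y) in uniformity. x' = x \<longrightarrow> y \<in> S)" for S :: "'a lip0 set"
    by (rule open_lip0_def)
  show "norm f = 0 \<longleftrightarrow> f = 0"
  proof
    assume "norm f = 0"
    then have "apply_lip0 f x = 0" for x
      using norm_lip0_bound[of f x 0] by simp
    then show "f = 0"
      by (intro lip0_eqI) (simp add: zero_lip0.rep_eq)
  next
    assume "f = 0"
    then show "norm f = 0"
      by (intro antisym norm_lip0_nonneg norm_lip0_le) (simp_all add: zero_lip0.rep_eq)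
  qed
  show "norm (f + g) \<le> norm f + norm g"
  proof (rule norm_lip0_le)
    fix x y
    show "\<bar>apply_lip0 (f + g) x - apply_lip0 (f + g) y\<bar> \<le> (norm f + norm g) * dist x y"
      using norm_lip0_bound[of f x y] norm_lip0_bound[of g x y]
      by (simp add: plus_lip0.rep_eq distrib_right)
  qed (simp add: norm_lip0_nonneg)
  show "norm (a *\<^sub>R f) = \<bar>a\<bar> * norm f"
  proof (rule antisym[OF norm_lip0_scaleR_le])
    show "\<bar>a\<bar> * norm f \<le> norm (a *\<^sub>R f)"
    proof (cases "a = 0")
      case False
      then have "f = inverse a *\<^sub>R (a *\<^sub>R f)"
        by transfer (simp add: fun_eq_iff)
      then have "norm f \<le> \<bar>inverse a\<bar> * norm (a *\<^sub>R f)"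
        using norm_lip0_scaleR_le[of "inverse a" "a *\<^sub>R f"] by simp
      then show ?thesis
        using False by (simp add: field_simps)
    qed (simp add: norm_lip0_nonneg)
  qed
qed

end

instance lip0 :: ("{metric_space, zero}") banach
proof
  fix X :: "nat \<Rightarrow> 'a lip0"
  assume X: "Cauchy X"
  have diff_bound:
    "\<bar>(apply_lip0 (X m) x - apply_lip0 (X n) x) - (apply_lip0 (X m) y - apply_lip0 (X n) y)\<bar>
      \<le> norm (X m - X n) * dist x y" for m n x y
    using norm_lip0_bound[of "X m - X n" x y] by (simp add: minus_lip0.rep_eq)
  have "\<exists>l. (\<lambda>n. apply_lip0 (X n) x) \<longlonglongrightarrow> l" for x
  proof -
    have "Cauchy (\<lambda>n. apply_lip0 (X n) x)"
    proof (rule CauchyI)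
      fix e :: real
      assume "0 < e"
      then have "0 < e / (dist x 0 + 1)"
        by (simp add: add_nonneg_pos)
      then obtain N where N: "\<And>m n. m \<ge> N \<Longrightarrow> n \<ge> N \<Longrightarrow> norm (X m - X n) < e / (dist x 0 + 1)"
        using CauchyD[OF X] by blast
      show "\<exists>N. \<forall>m\<ge>N. \<forall>n\<ge>N. norm (apply_lip0 (X m) x - apply_lip0 (X n) x) < e"
      proof (intro exI allI impI)
        fix m n
        assume "N \<le> m" "N \<le> n"
        then have lt: "norm (X m - X n) * (dist x 0 + 1) < e"
          using N by (simp add: pos_less_divide_eq add_nonneg_pos)
        have "norm (apply_lip0 (X m) x - apply_lip0 (X n) x) \<le> norm (X m - X n) * dist x 0"
          using diff_bound[of m x n 0] by simp
        also have "\<dots> \<le> norm (X m - X n) * (dist x 0 + 1)"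
          by (intro mult_left_mono) auto
        finally show "norm (apply_lip0 (X m) x - apply_lip0 (X n) x) < e"
          using lt by simp
      qed
    qed
    then show ?thesis
      by (simp add: Cauchy_convergent_iff convergent_def)
  qed
  then obtain F where F: "\<And>x. (\<lambda>n. apply_lip0 (X n) x) \<longlonglongrightarrow> F x"
    by metis
  have close: "\<bar>(apply_lip0 (X n) x - F x) - (apply_lip0 (X n) y - F y)\<bar> \<le> e * dist x y"
    if N: "\<And>m. m \<ge> N \<Longrightarrow> norm (X n - X m) \<le> e" for N n e x y
  proof (rule tendsto_upperbound)
    show "(\<lambda>m. \<bar>(apply_lip0 (X n) x - apply_lip0 (X m) x) -
        (apply_lip0 (X n) y - apply_lip0 (X m) y)\<bar>)
      \<longlonglongrightarrow> \<bar>(apply_lip0 (X n) x - F x) - (apply_lip0 (X n) y - F y)\<bar>"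
      by (intro tendsto_intros F)
    show "\<forall>\<^sub>F m in sequentially. \<bar>(apply_lip0 (X n) x - apply_lip0 (X m) x) -
        (apply_lip0 (X n) y - apply_lip0 (X m) y)\<bar> \<le> e * dist x y"
      using eventually_ge_at_top[of N]
    proof eventually_elim
      case (elim m)
      then show ?case
        using order_trans[OF diff_bound[of n x m y] mult_right_mono[OF N[OF elim], of "dist x y"]]
        by simp
    qed
  qed simp
  obtain N where N: "\<And>m n. m \<ge> N \<Longrightarrow> n \<ge> N \<Longrightarrow> norm (X m - X n) < 1"
    using CauchyD[OF X, of 1] by auto
  have "(norm (X N) + 1)-lipschitz_on UNIV F"
  proof (rule lipschitz_onI)
    fix x y
    have "\<bar>(apply_lip0 (X N) x - F x) - (apply_lip0 (X N) y - F y)\<bar> \<le> 1 * dist x y"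
      by (rule close[of N]) (simp add: N less_imp_le)
    then show "dist (F x) (F y) \<le> (norm (X N) + 1) * dist x y"
      using norm_lip0_bound[of "X N" x y] by (simp add: dist_real_def distrib_right)
  qed (simp add: add_nonneg_nonneg)
  moreover have "F 0 = 0"
    using F[of 0] by (simp add: LIMSEQ_const_iff)
  ultimately have app: "apply_lip0 (Lip0 F) = F"
    by (intro Lip0_inverse) auto
  have "X \<longlonglongrightarrow> Lip0 F"
  proof (rule LIMSEQ_I)
    fix r :: real
    assume "0 < r"
    then obtain N where N: "\<And>m n. m \<ge> N \<Longrightarrow> n \<ge> N \<Longrightarrow> norm (X m - X n) < r / 2"
      using CauchyD[OF X, of "r / 2"] by auto
    have "norm (X n - Lip0 F) \<le> r / 2" if "n \<ge> N" for n
    proof (rule norm_lip0_le)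
      fix x y
      show "\<bar>apply_lip0 (X n - Lip0 F) x - apply_lip0 (X n - Lip0 F) y\<bar> \<le> r / 2 * dist x y"
        using close[of N n "r / 2" x y] N[OF that] by (simp add: minus_lip0.rep_eq app less_imp_le)
    qed (use \<open>0 < r\<close> in simp)
    then show "\<exists>N. \<forall>n\<ge>N. norm (X n - Lip0 F) < r"
      using \<open>0 < r\<close> by (intro exI[of _ N]) fastforce
  qed
  then show "convergent X"
    by (auto simp: convergent_def)
qed

definition gromov_product :: "'a::metric_space \<Rightarrow> 'a \<Rightarrow> 'a \<Rightarrow> real" where
  "gromov_product x y z = (dist x z + dist z y - dist x y) / 2"

definition uniformly_gromov_concave :: "'a::metric_space set \<Rightarrow> bool" where
  "uniformly_gromov_concave M \<longleftrightarrow>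
    (\<exists>\<epsilon>>0. \<forall>x\<in>M. \<forall>y\<in>M. \<forall>z\<in>M. x \<noteq> y \<and> y \<noteq> z \<and> x \<noteq> z \<longrightarrow>
      gromov_product x y z > \<epsilon> * min (dist x z) (dist y z))"

text \<open>
  A collection of balls is a set of pairs of a center and a radius. The empty collection is
  allowed; it is needed only for the zero space, whose unit sphere is empty.
\<close>

definition UBCP :: "'a::real_normed_vector itself \<Rightarrow> bool" where
  "UBCP _ \<longleftrightarrow>
    (\<exists>r>0. \<exists>\<alpha>>0. \<exists>B :: ('a \<times> real) set. countable B \<and>
      sphere 0 1 \<subseteq> (\<Union>(z, s)\<in>B. ball z s) \<and>
      (\<forall>(z, s)\<in>B. 0 < s \<and> norm z \<ge> s + \<alpha> \<and> s \<le> r))"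

definition BCP :: "'a::real_normed_vector itself \<Rightarrow> real \<Rightarrow> bool" where
  "BCP _ \<alpha> \<longleftrightarrow>
    (\<exists>B :: ('a \<times> real) set. countable B \<and>
      sphere 0 1 \<subseteq> (\<Union>(z, s)\<in>B. ball z s) \<and>
      (\<forall>(z, s)\<in>B. 0 < s \<and> norm z \<ge> s + \<alpha>))"

definition bc :: "'a::real_normed_vector itself \<Rightarrow> real" where
  "bc Z = (let A = {\<alpha>. -1 \<le> \<alpha> \<and> \<alpha> < 1 \<and> BCP Z \<alpha>} in if A = {} then -1 else Sup A)"

end

theory Submission
  imports Defs
begin

text \<open>
  A norm-one function \<open>f\<close> almost attains its norm at a pair \<open>x\<close>, \<open>y\<close> of points of a countable
  dense set. Gromov concavity makes the pair exposed, uniformly in \<open>x\<close> and \<open>y\<close>: there is a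
  norm-one function \<open>h\<close> with \<open>h x - h y = dist x y\<close> whose slopes are at most some \<open>k < 1\<close> except
  between points near \<open>x\<close> and points near \<open>y\<close>, where \<open>f\<close> has slope almost \<open>1\<close> as well. Hence for
  large \<open>\<kappa>\<close>, independent of \<open>f\<close>, the function \<open>\<kappa> h - f\<close> has norm at most \<open>\<kappa> - \<beta>\<close> with \<open>\<beta>\<close> as close
  to \<open>1\<close> as desired, and \<open>f\<close> lies in a ball around \<open>\<kappa> h\<close>.
\<close>

section \<open>Peak functions and normalized concavity\<close>

text \<open>A cone of height \<open>dist x y / 2\<close> and slope \<open>k\<close> with apex
  \<open>x\<close>, minus the same cone at \<open>y\<close>. Taking \<open>k < 1\<close> keeps
  slopes on each cone small but widens the supports beyond half the distance; concavity will keep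
  them apart.\<close>

definition peak :: "real \<Rightarrow> 'a::metric_space \<Rightarrow> 'a \<Rightarrow> 'a \<Rightarrow> real" where
  "peak k x y t = max 0 (dist x y / 2 - k * dist t x) - max 0 (dist x y / 2 - k * dist t y)"

text \<open>Each cone vanishes at the apex of the other. This equality will bound the norms of the
  ball centers from below.\<close>

lemma peak_diff:
  assumes "1/2 \<le> k"
  shows "peak k x y x - peak k x y y = dist x y"
proof -
  have "dist x y / 2 - k * dist x y \<le> 0"
    using mult_right_mono[OF assms, of "dist x y"] by simp
  then show ?thesis
    by (simp add: peak_def dist_commute max_def)
qed

text \<open>With a constant at most 1/4 and a non-strict inequality, concavity extends to coinciding
  points.\<close>

lemma uniformly_gromov_concaveE:
  assumes "uniformly_gromov_concave (UNIV :: 'a::metric_space set)"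
  obtains \<epsilon> where "0 < \<epsilon>" "\<epsilon> \<le> 1/4"
    "\<And>x y z :: 'a. dist x y + 2 * \<epsilon> * min (dist x z) (dist z y) \<le> dist x z + dist z y"
proof -
  obtain e where e: "0 < e"
    and conc: "\<And>x y z :: 'a. x \<noteq> y \<Longrightarrow> y \<noteq> z \<Longrightarrow> x \<noteq> z \<Longrightarrow>
      gromov_product x y z > e * min (dist x z) (dist y z)"
    using assms unfolding uniformly_gromov_concave_def by auto
  define \<epsilon> where "\<epsilon> = min e (1/4)"
  have \<epsilon>: "0 < \<epsilon>" "\<epsilon> \<le> 1/4" "\<epsilon> \<le> e"
    using e by (auto simp: \<epsilon>_def)
  have "dist x y + 2 * \<epsilon> * min (dist x z) (dist z y) \<le> dist x z + dist z y" for x y z :: 'a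
  proof (cases "x = y \<or> y = z \<or> x = z")
    case True
    moreover have "\<epsilon> * dist x z \<le> 1 * dist x z"
      using \<epsilon> by (intro mult_right_mono) auto
    ultimately show ?thesis
      by (auto simp: dist_commute)
  next
    case False
    then have "gromov_product x y z > e * min (dist x z) (dist y z)"
      using conc by blast
    moreover have "\<epsilon> * min (dist x z) (dist y z) \<le> e * min (dist x z) (dist y z)"
      using \<epsilon> by (intro mult_right_mono) auto
    ultimately show ?thesis
      by (simp add: gromov_product_def dist_commute[of z y])
  qed
  with \<epsilon> that show thesis
    by blast
qed

section \<open>Geometry near a pair of points and slopes of its peak\<close>

context
  fixes \<epsilon> \<tau> :: real and x y :: "'a::metric_space"
  assumes \<epsilon>: "0 < \<epsilon>" "\<epsilon> \<le> 1/4" and \<tau>: "0 < \<tau>" "\<tau> \<le> 1/4"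
    and concave: "\<And>x y z :: 'a. dist x y + 2 * \<epsilon> * min (dist x z) (dist z y) \<le> dist x z + dist z y"
    and neq: "x \<noteq> y"
begin

lemma eta_bounds: "0 < \<epsilon> * \<tau>" "\<epsilon> * \<tau> \<le> 1/16" "\<epsilon> * \<tau> \<le> 2 * \<epsilon>"
proof -
  show "0 < \<epsilon> * \<tau>"
    using \<epsilon> \<tau> by simp
  show "\<epsilon> * \<tau> \<le> 1/16"
    using mult_mono[of \<epsilon> "1/4" \<tau> "1/4"] \<epsilon> \<tau> by simp
  show "\<epsilon> * \<tau> \<le> 2 * \<epsilon>"
    using mult_left_mono[of \<tau> 2 \<epsilon>] \<epsilon> \<tau> by (simp add: mult.commute)
qed

text \<open>With \<open>\<eta> = \<epsilon> * \<tau>\<close>, concavity makes the distance sum of a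
  point far from both foci at least \<open>(1 + 2 * \<eta>) * dist x y\<close>, and
  \<open>(1 - \<eta>) * (1 + 2 * \<eta>) \<ge> 1\<close> since
  \<open>\<eta> \<le> 1/2\<close>.\<close>

lemma thin_ellipse_near_foci:
  assumes "(1 - \<epsilon> * \<tau>) * (dist t x + dist t y) < dist x y"
  shows "dist t x \<le> \<tau> * dist x y \<or> dist t y \<le> \<tau> * dist x y"
proof (rule ccontr)
  define \<eta> where "\<eta> = \<epsilon> * \<tau>"
  note \<eta> = eta_bounds[folded \<eta>_def]
  assume "\<not> ?thesis"
  then have "\<tau> * dist x y \<le> min (dist x t) (dist t y)"
    by (simp add: dist_commute)
  then have "2 * \<epsilon> * (\<tau> * dist x y) \<le> 2 * \<epsilon> * min (dist x t) (dist t y)"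
    using \<epsilon> by (intro mult_left_mono) auto
  then have "dist x y * (1 + 2 * \<eta>) \<le> dist t x + dist t y"
    using concave[of x y t] by (simp add: \<eta>_def dist_commute algebra_simps)
  then have "(1 - \<eta>) * (dist x y * (1 + 2 * \<eta>)) \<le> (1 - \<eta>) * (dist t x + dist t y)"
    using \<eta> by (intro mult_left_mono) auto
  also have "\<dots> < dist x y"
    using assms by (simp add: \<eta>_def)
  finally have "dist x y * (\<eta> * (1 - 2 * \<eta>)) < 0"
    by (simp add: algebra_simps)
  moreover have "0 \<le> dist x y * (\<eta> * (1 - 2 * \<eta>))"
    using \<eta> by (intro mult_nonneg_nonneg) auto
  ultimately show False
    by linarith
qed

text \<open>Near \<open>w\<close> the distance to \<open>z\<close> is at least 3/4 of
  \<open>dist z w\<close>, and 15/16 times 3/4 exceeds 1/2. Hence the cone at one focus vanishes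
  near the other.\<close>

lemma half_less_far_dist:
  assumes "dist t w \<le> \<tau> * dist z w"
    and "z \<noteq> w"
  shows "dist z w / 2 < (1 - \<epsilon> * \<tau>) * dist t z"
proof -
  have "\<tau> * dist z w \<le> 1/4 * dist z w"
    using \<tau> by (intro mult_right_mono) auto
  then have "dist z w * (3/4) \<le> dist t z"
    using assms dist_triangle3[of z w t] by linarith
  then have "(15/16) * (dist z w * (3/4)) \<le> (1 - \<epsilon> * \<tau>) * dist t z"
    using eta_bounds by (intro mult_mono) auto
  moreover have "0 < dist z w"
    using assms by simp
  ultimately show ?thesis
    by linarith
qed

text \<open>Concavity is used twice, for \<open>v\<close> between \<open>x\<close> and
  \<open>y\<close> and for \<open>u\<close> between \<open>x\<close> and \<open>v\<close>. Nearness
  makes the short distance the minimum both times.\<close>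

lemma dist_near_pair:
  assumes u: "dist u x \<le> \<tau> * dist x y" and v: "dist v y \<le> \<tau> * dist x y"
  shows "dist x y - (1 - \<epsilon> * \<tau>) * (dist u x + dist v y) \<le> dist u v"
proof -
  have le: "\<tau> * dist x y \<le> dist x y / 4"
    using mult_right_mono[OF \<tau>(2), of "dist x y"] by simp
  have "dist v y \<le> dist x v"
    using v le dist_triangle[of x y v] zero_le_dist[of x y] by linarith
  then have 1: "dist x y + 2 * \<epsilon> * dist v y \<le> dist x v + dist v y"
    using concave[of x y v] by simp
  have "dist u x \<le> dist u v"
    using u v le dist_triangle[of x v u] dist_triangle[of x y v] zero_le_dist[of x y]
      dist_commute[of x u] by linarith
  then have 2: "dist x v + 2 * \<epsilon> * dist u x \<le> dist u x + dist u v"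
    using concave[of x v u] by (simp add: dist_commute)
  have "\<epsilon> * \<tau> * (dist u x + dist v y) \<le> 2 * \<epsilon> * (dist u x + dist v y)"
    using eta_bounds by (intro mult_right_mono) auto
  with 1 2 show ?thesis
    by (simp add: algebra_simps)
qed

lemma peak_slope:
  defines "k \<equiv> 1 - \<epsilon> * \<tau>"
  shows "peak k x y u - peak k x y v \<le> k * dist u v \<or>
    dist u x \<le> \<tau> * dist x y \<and> dist v y \<le> \<tau> * dist x y \<and>
    peak k x y u - peak k x y v \<le> dist u v"
proof -
  define p where "p t = dist x y / 2 - k * dist t x" for t
  define q where "q t = k * dist t y - dist x y / 2" for t
  have k: "0 \<le> k"
    using eta_bounds by (simp add: k_def)
  have peak: "peak k x y t = max 0 (p t) - max 0 (- q t)" for t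
    by (simp add: peak_def p_def q_def)
  have p_lip: "p u - p v \<le> k * dist u v"
    using mult_left_mono[OF dist_triangle[of v x u] k]
    by (simp add: p_def dist_commute algebra_simps)
  have q_lip: "q u - q v \<le> k * dist u v"
    using mult_left_mono[OF dist_triangle[of u y v] k]
    by (simp add: q_def dist_commute algebra_simps)
  \<comment> \<open>The condition \<open>q t < p t\<close> says that \<open>t\<close> lies in the
    thin ellipse with foci \<open>x\<close> and \<open>y\<close>.\<close>
  have near: "dist t x \<le> \<tau> * dist x y \<and> 0 < q t \<or> dist t y \<le> \<tau> * dist x y \<and> p t < 0"
    if "q t < p t" for t
  proof -
    have "k * (dist t x + dist t y) < dist x y"
      using that by (simp add: p_def q_def algebra_simps)
    then have "dist t x \<le> \<tau> * dist x y \<or> dist t y \<le> \<tau> * dist x y"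
      unfolding k_def by (rule thin_ellipse_near_foci)
    then show ?thesis
      using half_less_far_dist[of t x y] half_less_far_dist[of t y x] neq
      by (auto simp: p_def q_def k_def dist_commute)
  qed
  have dist0: "0 \<le> k * dist u v"
    using k by simp
  show ?thesis
  \<comment> \<open>In each of these cases the increment of the peak is at most 0 or that of
    \<open>p\<close> or \<open>q\<close>. Otherwise \<open>u\<close> lies on the positive cone,
    \<open>v\<close> on the negative one, and both in the thin ellipse.\<close>
  proof (cases "p u \<le> 0 \<or> 0 \<le> q v \<or> p v \<le> q v \<or> p u \<le> q u")
    case True
    \<comment> \<open>The two bumps making up the peak have disjoint supports.\<close>
    have "\<not> (0 < p t \<and> q t < 0)" for t
      using near[of t] by auto
    then have "p u \<le> 0 \<or> 0 \<le> q u" "p v \<le> 0 \<or> 0 \<le> q v"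
      by (meson not_le)+
    with True have "peak k x y u - peak k x y v \<le> k * dist u v"
      using p_lip q_lip dist0 unfolding peak by linarith
    then show ?thesis ..
  next
    case False
    then have nu: "dist u x \<le> \<tau> * dist x y" "0 < q u" and nv: "dist v y \<le> \<tau> * dist x y" "p v < 0"
      using near[of u] near[of v] by auto
    then have "peak k x y u - peak k x y v = dist x y - k * (dist u x + dist v y)"
      using False by (simp add: peak max_def) (simp add: p_def q_def algebra_simps)
    with dist_near_pair[OF nu(1) nv(1)] nu nv show ?thesis
      by (simp add: k_def)
  qed
qed

lemma lipschitz_peak: "1-lipschitz_on UNIV (\<lambda>t. peak (1 - \<epsilon> * \<tau>) x y t - c)"
proof (rule lipschitz_onI)
  have "peak (1 - \<epsilon> * \<tau>) x y u - peak (1 - \<epsilon> * \<tau>) x y v \<le> dist u v" for u v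
  proof -
    have "(1 - \<epsilon> * \<tau>) * dist u v \<le> 1 * dist u v"
      using eta_bounds by (intro mult_right_mono) auto
    then show ?thesis
      using peak_slope[of u v] by auto
  qed
  then show "dist (peak (1 - \<epsilon> * \<tau>) x y u - c) (peak (1 - \<epsilon> * \<tau>) x y v - c) \<le> 1 * dist u v" for u v
    by (simp add: dist_real_def abs_le_iff) (metis dist_commute)
qed simp

end

section \<open>Steep pairs of a norm-one function\<close>

text \<open>Moving both endpoints costs at most \<open>2 * \<tau> * dist x y\<close> in the distance
  and in the increment of \<open>f\<close>; the bound on \<open>5 * \<tau>\<close> absorbs
  both.\<close>

lemma slope_near_pair:
  fixes f :: "'a::metric_space \<Rightarrow> real"
  assumes lip: "\<And>u v. \<bar>f u - f v\<bar> \<le> dist u v"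
    and slope: "(1 - \<tau>) * dist x y \<le> f x - f y"
    and near: "dist u x \<le> \<tau> * dist x y" "dist v y \<le> \<tau> * dist x y"
    and \<beta>: "0 \<le> \<beta>" "\<beta> \<le> 1" "5 * \<tau> \<le> 1 - \<beta>"
  shows "\<beta> * dist u v \<le> f u - f v"
proof -
  have \<tau>d: "0 \<le> \<tau> * dist x y"
    using near zero_le_dist order_trans by blast
  have "dist u v \<le> dist x y + 2 * (\<tau> * dist x y)"
    using near dist_triangle[of u v x] dist_triangle[of x v y] by (simp add: dist_commute)
  then have "\<beta> * dist u v \<le> \<beta> * (dist x y + 2 * (\<tau> * dist x y))"
    using \<beta> by (intro mult_left_mono)
  also have "\<dots> \<le> \<beta> * dist x y + 2 * (\<tau> * dist x y)"
    using mult_right_mono[OF \<beta>(2) \<tau>d] by (simp add: distrib_left)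
  also have "\<dots> \<le> (1 - 3 * \<tau>) * dist x y"
    using mult_right_mono[OF \<beta>(3), of "dist x y"] by (simp add: algebra_simps)
  also have "\<dots> \<le> f u - f v"
    using slope near lip[of u x] lip[of v y] by (simp add: algebra_simps abs_le_iff)
  finally show ?thesis .
qed

lemma ex_steep_pair:
  fixes f :: "'a::{metric_space, zero} lip0"
  assumes "norm f = 1" "0 < \<delta>" "\<delta> \<le> 1" "closure D = UNIV"
  obtains x y where "x \<in> D" "y \<in> D" "x \<noteq> y"
    "(1 - \<delta>) * dist x y \<le> apply_lip0 f x - apply_lip0 f y"
proof -
  let ?f = "apply_lip0 f"
  have lip: "\<bar>?f u - ?f v\<bar> \<le> dist u v" for u v
    using norm_lip0_bound[of f u v] assms by simp
  have "\<exists>x y. (1 - \<delta>) * dist x y < \<bar>?f x - ?f y\<bar>"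
  proof (rule ccontr)
    assume "\<nexists>x y. (1 - \<delta>) * dist x y < \<bar>?f x - ?f y\<bar>"
    then have "norm f \<le> 1 - \<delta>"
      using assms by (intro norm_lip0_le) (auto simp: not_less)
    then show False
      using assms by simp
  qed
  then obtain x y where "(1 - \<delta>) * dist x y < ?f x - ?f y"
    by (metis abs_real_def dist_commute minus_diff_eq)
  define \<gamma> where "\<gamma> = ?f x - ?f y - (1 - \<delta>) * dist x y"
  have \<gamma>: "0 < \<gamma>"
    using \<open>_ < ?f x - ?f y\<close> by (simp add: \<gamma>_def)
  \<comment> \<open>Moving each point by less than \<open>\<gamma> / 8\<close> uses up at most
    \<open>\<gamma> / 4\<close> on either side of the inequality, less than the slack
    \<open>\<gamma>\<close> in total.\<close>
  then obtain x' y' where D: "x' \<in> D" "y' \<in> D" and close: "dist x' x < \<gamma> / 8" "dist y' y < \<gamma> / 8"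
    using assms(4) by (metis UNIV_I closure_approachable divide_pos_pos zero_less_numeral)
  have "dist x' y' \<le> dist x y + \<gamma> / 4"
    using close dist_triangle[of x' y' x] dist_triangle[of x y' y] by (simp add: dist_commute)
  then have "(1 - \<delta>) * dist x' y' \<le> (1 - \<delta>) * (dist x y + \<gamma> / 4)"
    using assms by (intro mult_left_mono) auto
  also have "\<dots> \<le> (1 - \<delta>) * dist x y + \<gamma> / 4"
    using \<gamma> assms by (simp add: algebra_simps)
  also have "\<dots> < ?f x' - ?f y'"
    using close \<gamma> lip[of x' x] lip[of y' y] \<gamma>_def unfolding abs_le_iff by linarith
  finally have less: "(1 - \<delta>) * dist x' y' < ?f x' - ?f y'" .
  then have "x' \<noteq> y'"
    by auto
  with D less that show thesis
    by force
qed

section \<open>The countable cover\<close>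

text \<open>The common radius provides the uniform bound in \<open>UBCP\<close>, the freedom in
  \<open>\<alpha>\<close> the value of \<open>bc\<close>.\<close>

lemma countable_cover_equal_radii:
  fixes \<alpha> :: real
  assumes sep: "separable_space (euclidean :: 'a::{metric_space, zero} topology)"
    and "uniformly_gromov_concave (UNIV :: 'a::{metric_space, zero} set)"
    and \<alpha>: "-1 \<le> \<alpha>" "\<alpha> < 1"
  obtains s and Z :: "'a::{metric_space, zero} lip0 set" where "0 < s" "countable Z" "sphere 0 1 \<subseteq> (\<Union>z\<in>Z. ball z s)"
    "\<And>z. z \<in> Z \<Longrightarrow> s + \<alpha> \<le> norm z"
proof -
  obtain \<epsilon> where \<epsilon>: "0 < \<epsilon>" "\<epsilon> \<le> 1/4"
    and concave: "\<And>x y z :: 'a. dist x y + 2 * \<epsilon> * min (dist x z) (dist z y) \<le> dist x z + dist z y"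
    using uniformly_gromov_concaveE[OF assms(2)] by blast
  obtain D :: "'a set" where D: "countable D" "closure D = UNIV"
    using sep unfolding separable_space_def by auto
  \<comment> \<open>The midpoint of \<open>\<alpha>\<close> and 1: \<open>\<beta> < 1\<close> leaves
    room for \<open>\<tau> > 0\<close>, and \<open>\<alpha> < \<beta>\<close> puts functions at
    distance up to \<open>\<kappa> - \<beta>\<close> inside the open ball of radius
    \<open>\<kappa> - \<alpha>\<close>.\<close>
  define \<beta> where "\<beta> = (1 + \<alpha>) / 2"
  define \<tau> where "\<tau> = (1 - \<beta>) / 5"
  define k where "k = 1 - \<epsilon> * \<tau>"
  \<comment> \<open>Chosen so that \<open>\<kappa> * (1 - k) = 2\<close>: where the peak has slope
    at most \<open>k\<close>, subtracting \<open>f\<close> still leaves slope at most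
    \<open>\<kappa> - 1\<close>.\<close>
  define \<kappa> where "\<kappa> = 2 / (\<epsilon> * \<tau>)"
  have \<beta>: "0 \<le> \<beta>" "\<beta> < 1" "\<alpha> < \<beta>"
    using \<alpha> by (auto simp: \<beta>_def)
  have \<tau>: "0 < \<tau>" "\<tau> \<le> 1/4" "5 * \<tau> = 1 - \<beta>"
    using \<beta> by (auto simp: \<tau>_def)
  have \<epsilon>\<tau>: "0 < \<epsilon> * \<tau>" "\<epsilon> * \<tau> \<le> 1/16"
    using \<epsilon> \<tau> mult_mono[of \<epsilon> "1/4" \<tau> "1/4"] by auto
  have "\<kappa> * (\<epsilon> * \<tau>) = 2"
    using \<epsilon>(1) \<tau>(1) by (simp add: \<kappa>_def)
  then have "\<kappa> * k = \<kappa> - 2"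
    by (simp add: k_def right_diff_distrib)
  moreover have "2 \<le> \<kappa>"
    using \<epsilon>\<tau> by (simp add: \<kappa>_def pos_le_divide_eq)
  ultimately have \<kappa>: "2 \<le> \<kappa>" "\<kappa> * k = \<kappa> - 2"
    by blast+
  define h where "h x y = Lip0 (\<lambda>t. peak k x y t - peak k x y 0)" for x y :: 'a
  have h: "apply_lip0 (h x y) t = peak k x y t - peak k x y 0" if "x \<noteq> y" for x y t
  proof -
    have "1-lipschitz_on UNIV (\<lambda>t. peak k x y t - peak k x y 0)"
      unfolding k_def using \<epsilon> \<tau>(1,2) concave that by (rule lipschitz_peak)
    then show ?thesis
      unfolding h_def by (subst Lip0_inverse) auto
  qed
  define Z where "Z = (\<lambda>(x, y). \<kappa> *\<^sub>R h x y) ` {(x, y) \<in> D \<times> D. x \<noteq> y}"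
  show thesis
  proof
    show "0 < \<kappa> - \<alpha>"
      using \<kappa> \<alpha> by simp
    show "countable Z"
      unfolding Z_def using D by (auto intro!: countable_image intro: countable_subset[of _ "D \<times> D"])
    show "sphere 0 1 \<subseteq> (\<Union>z\<in>Z. ball z (\<kappa> - \<alpha>))"
    proof
      fix f :: "'a lip0"
      assume "f \<in> sphere 0 1"
      then have f: "norm f = 1"
        by simp
      let ?f = "apply_lip0 f"
      have lip: "\<bar>?f u - ?f v\<bar> \<le> dist u v" for u v
        using norm_lip0_bound[of f u v] f by simp
      obtain x y where xy: "x \<in> D" "y \<in> D" "x \<noteq> y"
        and steep: "(1 - \<tau>) * dist x y \<le> ?f x - ?f y"
        using ex_steep_pair[OF f, of \<tau> D] \<tau> D by auto
      \<comment> \<open>Exchanging \<open>u\<close> and \<open>v\<close> turns this signed bound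
        into one on the absolute value.\<close>
      have one_sided: "\<kappa> * (peak k x y u - peak k x y v) - (?f u - ?f v) \<le> (\<kappa> - \<beta>) * dist u v" for u v
        using peak_slope[OF \<epsilon> \<tau>(1,2) concave xy(3), of u v, folded k_def]
      proof (elim disjE conjE)
        assume "peak k x y u - peak k x y v \<le> k * dist u v"
        then have "\<kappa> * (peak k x y u - peak k x y v) \<le> \<kappa> * (k * dist u v)"
          using \<kappa> by (intro mult_left_mono) auto
        also have "\<dots> = (\<kappa> - 2) * dist u v"
          using \<kappa> by (metis mult.assoc)
        finally have "\<kappa> * (peak k x y u - peak k x y v) - (?f u - ?f v) \<le> (\<kappa> - 1) * dist u v"
          using lip[of u v] by (simp add: algebra_simps abs_le_iff)
        also have "\<dots> \<le> (\<kappa> - \<beta>) * dist u v"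
          using \<beta> by (intro mult_right_mono) auto
        finally show ?thesis .
      next
        assume near: "dist u x \<le> \<tau> * dist x y" "dist v y \<le> \<tau> * dist x y"
          and "peak k x y u - peak k x y v \<le> dist u v"
        then have "\<kappa> * (peak k x y u - peak k x y v) \<le> \<kappa> * dist u v"
          using \<kappa> by (intro mult_left_mono) auto
        moreover have "\<beta> * dist u v \<le> ?f u - ?f v"
          using slope_near_pair[of ?f, OF lip steep near] \<beta> \<tau> by simp
        ultimately show ?thesis
          by (simp add: algebra_simps)
      qed
      have "norm (\<kappa> *\<^sub>R h x y - f) \<le> \<kappa> - \<beta>"
      proof (rule norm_lip0_le)
        fix u v
        show "\<bar>apply_lip0 (\<kappa> *\<^sub>R h x y - f) u - apply_lip0 (\<kappa> *\<^sub>R h x y - f) v\<bar> \<le> (\<kappa> - \<beta>) * dist u v"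
          using one_sided[of u v] one_sided[of v u] xy(3)
          by (simp add: minus_lip0.rep_eq scaleR_lip0.rep_eq h abs_le_iff dist_commute algebra_simps)
      qed (use \<kappa> \<beta> in simp)
      then have "f \<in> ball (\<kappa> *\<^sub>R h x y) (\<kappa> - \<alpha>)"
        using \<beta> by (simp add: dist_norm)
      moreover have "\<kappa> *\<^sub>R h x y \<in> Z"
        using xy by (auto simp: Z_def)
      ultimately show "f \<in> (\<Union>z\<in>Z. ball z (\<kappa> - \<alpha>))"
        by blast
    qed
    show "\<kappa> - \<alpha> + \<alpha> \<le> norm z" if z: "z \<in> Z" for z
    proof -
      obtain x y where z_eq: "z = \<kappa> *\<^sub>R h x y" and "x \<noteq> y"
        using z by (auto simp: Z_def)
      have "peak k x y x - peak k x y y = dist x y"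
        using \<epsilon>\<tau> by (intro peak_diff) (simp add: k_def)
      then have "dist x y \<le> norm (h x y) * dist x y"
        using norm_lip0_bound[of "h x y" x y] \<open>x \<noteq> y\<close> by (simp add: h)
      then have "1 \<le> norm (h x y)"
        using \<open>x \<noteq> y\<close> by (simp add: mult_le_cancel_right1)
      then show ?thesis
        using \<kappa> mult_left_mono[of 1 "norm (h x y)" \<kappa>] by (simp add: z_eq)
    qed
  qed
qed

lemma Union_balls_Times_singleton: "(\<Union>(z, s')\<in>Z \<times> {s}. ball z s') = (\<Union>z\<in>Z. ball z s)"
  by auto

theorem theoremD:
  assumes "separable_space (euclidean :: 'a::{complete_space, zero} topology)"
    and "uniformly_gromov_concave (UNIV :: 'a set)"
  shows "UBCP TYPE('a lip0) \<and> bc TYPE('a lip0) = 1"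
proof
  \<comment> \<open>Any margin strictly between 0 and 1 would serve here.\<close>
  obtain s and Z :: "'a lip0 set" where "0 < s" "countable Z" "sphere 0 1 \<subseteq> (\<Union>z\<in>Z. ball z s)"
    "\<And>z. z \<in> Z \<Longrightarrow> s + 1/2 \<le> norm z"
    using countable_cover_equal_radii[OF assms, of "1/2"] by auto
  then have "countable (Z \<times> {s})" "sphere 0 1 \<subseteq> (\<Union>(z, s)\<in>Z \<times> {s}. ball z s)"
    "\<forall>(z, s')\<in>Z \<times> {s}. 0 < s' \<and> s' + 1/2 \<le> norm z \<and> s' \<le> s"
    by (simp_all add: Union_balls_Times_singleton)
  with \<open>0 < s\<close> show "UBCP TYPE('a lip0)"
    unfolding UBCP_def by (meson half_gt_zero zero_less_one)
  have "BCP TYPE('a lip0) \<alpha>" if \<alpha>: "-1 \<le> \<alpha>" "\<alpha> < 1" for \<alpha>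
  proof -
    obtain s and Z :: "'a lip0 set" where "0 < s" "countable Z" "sphere 0 1 \<subseteq> (\<Union>z\<in>Z. ball z s)"
      "\<And>z. z \<in> Z \<Longrightarrow> s + \<alpha> \<le> norm z"
      using countable_cover_equal_radii[OF assms \<alpha>] by auto
    then show ?thesis
      unfolding BCP_def
      by (intro exI[of _ "Z \<times> {s}"]) (simp add: Union_balls_Times_singleton)
  qed
  then have "{\<alpha>. -1 \<le> \<alpha> \<and> \<alpha> < 1 \<and> BCP TYPE('a lip0) \<alpha>} = {-1..<1}"
    by auto
  then show "bc TYPE('a lip0) = 1"
    by (simp add: bc_def Let_def)
qed

end
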